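(* Let $G$ be an arbitrary $n$-vertex graph, and let $(V_i, i \ge 1)$ be i.i.d. uniform random vertices of $G$. Let $T$ be the smallest $t$ such that every vertex of $G$ is contained in, or adjacent to, the set $\{V_i, 1 \le i \le t\}$. Then \[ \mathrm{var}\, T \le n\, \mathbb{E} T. \]
   Context: Graphs are finite and undirected. *)

theory Defs
  imports "HOL-Probability.Probability" "Graph_Theory.Digraph"
begin

(* "dominates" of Graph_Theory is the arc relation u -> v. On a symmetric digraph it is
   adjacency, so the orientation chosen here is immaterial. *)
definition dominating_set :: "('a, 'e) pre_digraph \<Rightarrow> 'a set \<Rightarrow> bool" where
  "dominating_set G S \<longleftrightarrow> (\<forall>v\<in>verts G. v \<in> S \<or> (\<exists>u\<in>S. u \<rightarrow>\<^bsub>G\<^esub> v))"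

(* The value is unspecified if no initial segment V 1, ..., V t is dominating. For i.i.d. uniform
   vertices this happens with probability 0. *)
definition domination_time :: "('a, 'e) pre_digraph \<Rightarrow> (nat \<Rightarrow> 'a) \<Rightarrow> nat" where
  "domination_time G V = (LEAST t. dominating_set G (V ` {1..t}))"

end

theory Submission
  imports Defs
begin

text \<open>
  Let \<open>h S\<close> be the mean remaining time once the set \<open>S\<close> has been collected. Waiting for one particular
  vertex \<open>v\<close> takes \<open>n\<close> draws on average, so \<open>h S \<le> n + h (insert v S)\<close>: no draw lowers the mean
  remaining time by more than \<open>n\<close>. In the martingale \<open>h (S\<^sub>t) + t\<close> the decrease \<open>x\<close> of \<open>h\<close> in one draw has
  conditional mean 1, and hence conditional variance at most \<open>E x\<^sup>2 \<le> n E x = n\<close>; summing over the draws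
  gives \<open>var T \<le> n E T\<close>.

  Only the monotonicity of domination matters. The time is truncated at a horizon \<open>t\<close>, which makes
  both moments finite sums and turns the martingale computation into an induction on \<open>t\<close>; the bound
  then passes to the limit by monotone convergence.
\<close>

section \<open>Truncated moments of the remaining time, by recursion on the horizon\<close>

locale monotone_collection =
  fixes U :: "'a set" and D :: "'a set \<Rightarrow> bool"
  assumes finite_U: "finite U" and nonempty_U: "U \<noteq> {}"
    and D_mono: "A \<subseteq> B \<Longrightarrow> D A \<Longrightarrow> D B"
    and D_U: "D U"
begin

text \<open>The probability that \<open>S\<close> together with \<open>t\<close> further uniform
  draws still fails \<open>D\<close>, computed by conditioning on the first of these draws;
  \<open>prob_undone\<close> confirms this reading.\<close>

fun undone :: "nat \<Rightarrow> 'a set \<Rightarrow> real" where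
  "undone 0 S = of_bool (\<not> D S)"
| "undone (Suc t) S = (\<Sum>v\<in>U. undone t (insert v S)) / real (card U)"

text \<open>
  First and second moments of the time truncated at \<open>t\<close>: a time \<open>T\<close> satisfies
  \<open>min T t = (\<Sum>s<t. [s < T])\<close> and \<open>(min T t)\<^sup>2 = (\<Sum>s<t. (2 s + 1) [s < T])\<close>.
\<close>

definition mean_time :: "nat \<Rightarrow> 'a set \<Rightarrow> real" where
  "mean_time t S = (\<Sum>s<t. undone s S)"

definition mean_square_time :: "nat \<Rightarrow> 'a set \<Rightarrow> real" where
  "mean_square_time t S = (\<Sum>s<t. (2 * real s + 1) * undone s S)"

lemma card_U_pos: "0 < real (card U)"
  using finite_U nonempty_U by (simp add: card_gt_0_iff)

lemma undone_nonneg: "0 \<le> undone t S"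
  by (induction t arbitrary: S) (auto intro!: divide_nonneg_nonneg sum_nonneg)

lemma undone_antimono: "A \<subseteq> B \<Longrightarrow> undone t B \<le> undone t A"
proof (induction t arbitrary: A B)
  case 0
  then show ?case using D_mono[of A B] by auto
next
  case (Suc t)
  show ?case
    using Suc.prems by (auto intro!: divide_right_mono sum_mono Suc.IH)
qed

lemma undone_eq_0: "D S \<Longrightarrow> undone t S = 0"
proof (induction t arbitrary: S)
  case (Suc t)
  have "undone t (insert v S) = 0" for v
    by (rule Suc.IH, rule D_mono[OF _ Suc.prems]) auto
  then show ?case by simp
qed simp

lemma mean_time_Suc:
  "mean_time (Suc t) S = of_bool (\<not> D S) + (\<Sum>v\<in>U. mean_time t (insert v S)) / real (card U)"
  unfolding mean_time_def sum.lessThan_Suc_shift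
  by (simp add: sum_divide_distrib[symmetric] sum.swap[of _ U])

text \<open>If T is the time remaining after one draw, the whole time is 1 + T, with square 1 + (T^2
  + 2 T). In the weights this is \<open>2 (s + 1) + 1 = (2 s + 1) + 2\<close>.\<close>

lemma mean_square_time_Suc:
  "mean_square_time (Suc t) S = of_bool (\<not> D S)
    + (\<Sum>v\<in>U. mean_square_time t (insert v S) + 2 * mean_time t (insert v S)) / real (card U)"
proof -
  have "(\<Sum>s<t. (2 * real (Suc s) + 1) * undone (Suc s) S)
    = (\<Sum>s<t. \<Sum>v\<in>U. ((2 * real s + 1) * undone s (insert v S) + 2 * undone s (insert v S)) / real (card U))"
    by (simp add: sum_divide_distrib sum_distrib_left algebra_simps add_divide_distrib sum.distrib)
  also have "\<dots> = (\<Sum>v\<in>U. mean_square_time t (insert v S) + 2 * mean_time t (insert v S)) / real (card U)"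
    by (subst sum.swap)
      (simp add: mean_square_time_def mean_time_def sum_divide_distrib sum_distrib_left sum.distrib add_divide_distrib)
  finally show ?thesis
    unfolding mean_square_time_def sum.lessThan_Suc_shift by simp
qed

lemma mean_time_antimono: "A \<subseteq> B \<Longrightarrow> mean_time t B \<le> mean_time t A"
  unfolding mean_time_def by (intro sum_mono undone_antimono)

lemma mean_time_mono: "mean_time t S \<le> mean_time (Suc t) S"
  by (simp add: mean_time_def undone_nonneg)

text \<open>Add the same draw \<open>u\<close> to \<open>S\<close> and to \<open>insert v S\<close>.
  If \<open>u = v\<close> the two collections coincide; otherwise the induction hypothesis loses n =
  \<open>card U\<close>. The average loss is n - 1, and the indicator for the current draw adds at
  most 1.\<close>

lemma mean_time_insert:
  assumes "v \<in> U"
  shows "mean_time t S \<le> real (card U) + mean_time t (insert v S)"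
proof (induction t arbitrary: S)
  case 0
  then show ?case by (simp add: mean_time_def)
next
  case (Suc t)
  let ?n = "real (card U)"
  have "(\<Sum>u\<in>U. mean_time t (insert u S))
    \<le> (\<Sum>u\<in>U. (if u = v then 0 else ?n) + mean_time t (insert u (insert v S)))"
  proof (rule sum_mono)
    fix u
    show "mean_time t (insert u S)
      \<le> (if u = v then 0 else ?n) + mean_time t (insert u (insert v S))"
      using Suc.IH[of "insert u S"] by (auto simp: insert_commute)
  qed
  also have "\<dots> = ?n * (?n - 1) + (\<Sum>u\<in>U. mean_time t (insert u (insert v S)))"
  proof -
    have "(\<Sum>u\<in>U. if u = v then 0 else ?n) = (\<Sum>u\<in>U. ?n) - (\<Sum>u\<in>U. if u = v then ?n else 0)"
      unfolding sum_subtractf[symmetric] by (rule sum.cong) auto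
    also have "\<dots> = ?n * (?n - 1)"
      using assms finite_U by (simp add: algebra_simps)
    finally show ?thesis by (simp add: sum.distrib)
  qed
  finally have "(\<Sum>u\<in>U. mean_time t (insert u S)) / ?n
    \<le> (?n * (?n - 1) + (\<Sum>u\<in>U. mean_time t (insert u (insert v S)))) / ?n"
    by (rule divide_right_mono) simp
  also have "\<dots> = ?n - 1 + (\<Sum>u\<in>U. mean_time t (insert u (insert v S))) / ?n"
    using card_U_pos by (simp add: add_divide_distrib)
  finally show ?case
    unfolding mean_time_Suc by (auto simp: of_bool_def)
qed

text \<open>Inserting the elements of \<open>U\<close> one by one costs at most
  \<open>card U\<close> each, by \<open>mean_time_insert\<close>; once all of \<open>U\<close> is
  present, nothing remains.\<close>

lemma mean_time_bounded: "mean_time t S \<le> (real (card U))\<^sup>2"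
proof -
  have "mean_time t S \<le> real (card U) * real (card W) + mean_time t (W \<union> S)" if "W \<subseteq> U" for W
    using finite_subset[OF that finite_U] that
  proof (induction W rule: finite_induct)
    case (insert v W)
    then show ?case
      using mean_time_insert[of v t "W \<union> S"] by (simp add: algebra_simps)
  qed simp
  from this[of U] show ?thesis
    using undone_eq_0[OF D_mono[OF _ D_U, of "U \<union> S"]]
    by (simp add: mean_time_def power2_eq_square)
qed

lemma mean_square_time_le:
  "mean_square_time t S \<le> (mean_time t S)\<^sup>2 + real (card U) * mean_time t S"
proof (induction t arbitrary: S)
  case 0
  then show ?case by (simp add: mean_time_def mean_square_time_def)
next
  case (Suc t)
  let ?n = "real (card U)"
  show ?case
  proof (cases "D S")
    case True
    then show ?thesis by (simp add: mean_time_def mean_square_time_def undone_eq_0)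
  next
    case False
    define h where "h = mean_time (Suc t) S"
    define x where "x v = h - mean_time t (insert v S)" for v
    have x_nonneg: "0 \<le> x v" for v
      using order_trans[OF mean_time_antimono mean_time_mono, of S "insert v S" t]
      by (auto simp: x_def h_def)
    have "(\<Sum>v\<in>U. mean_time t (insert v S)) \<le> (\<Sum>v\<in>U. mean_time t S)"
      by (intro sum_mono mean_time_antimono) auto
    then have "mean_time (Suc t) S \<le> 1 + mean_time t S"
      unfolding mean_time_Suc using False card_U_pos by (simp add: field_simps)
    \<comment> \<open>The two horizons differ by one draw, which costs the extra 1; it is paid for by subtracting the
      squared mean 1 of \<open>x\<close>, since a variance of at most \<open>n\<close> is all that is needed.\<close>
    then have x_le: "x v \<le> ?n + 1" if "v \<in> U" for v
      using mean_time_insert[OF that, of t S] by (simp add: x_def h_def)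
    have sum_h: "(\<Sum>v\<in>U. mean_time t (insert v S)) = ?n * (h - 1)"
      using False card_U_pos by (simp add: h_def mean_time_Suc)
    have sum_x: "(\<Sum>v\<in>U. x v) = ?n"
      by (simp add: x_def sum_subtractf sum_h algebra_simps)
    have sum_sq: "(\<Sum>v\<in>U. (x v)\<^sup>2) \<le> (?n + 1) * ?n"
    proof -
      have "(\<Sum>v\<in>U. (x v)\<^sup>2) \<le> (\<Sum>v\<in>U. (?n + 1) * x v)"
        unfolding power2_eq_square by (intro sum_mono mult_right_mono x_le x_nonneg)
      then show ?thesis by (simp add: sum_distrib_left[symmetric] sum_x)
    qed
    \<comment> \<open>The induction hypothesis at \<open>insert v S\<close>, with its mean written
      as \<open>h - x v\<close> and expanded in powers of \<open>x v\<close>.\<close>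
    have "(\<Sum>v\<in>U. mean_square_time t (insert v S) + 2 * mean_time t (insert v S))
      \<le> (\<Sum>v\<in>U. h\<^sup>2 + (?n + 2) * h - (2 * h + ?n + 2) * x v + (x v)\<^sup>2)"
    proof (rule sum_mono)
      fix v
      have "mean_time t (insert v S) = h - x v" by (simp add: x_def)
      then show "mean_square_time t (insert v S) + 2 * mean_time t (insert v S)
        \<le> h\<^sup>2 + (?n + 2) * h - (2 * h + ?n + 2) * x v + (x v)\<^sup>2"
        using Suc.IH[of "insert v S"] by (simp only:) (simp add: algebra_simps power2_eq_square)
    qed
    also have "\<dots> = ?n * (h\<^sup>2 + (?n + 2) * h) - (2 * h + ?n + 2) * ?n + (\<Sum>v\<in>U. (x v)\<^sup>2)"
      by (simp add: sum.distrib sum_subtractf sum_distrib_left[symmetric] sum_x)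
    \<comment> \<open>On average \<open>x\<close> is 1 and its square at most \<open>?n + 1\<close>.
      The -1 that is left makes room for the indicator in
      \<open>mean_square_time_Suc\<close>.\<close>
    also have "\<dots> \<le> ?n * (h\<^sup>2 + ?n * h - 1)"
      using sum_sq by (simp add: algebra_simps)
    finally have "(\<Sum>v\<in>U. mean_square_time t (insert v S) + 2 * mean_time t (insert v S)) / ?n
      \<le> h\<^sup>2 + ?n * h - 1"
      using card_U_pos by (simp add: field_simps)
    then show ?thesis
      unfolding mean_square_time_Suc h_def[symmetric] using False by simp
  qed
qed

text \<open>Finitely many draws take values in a finite discrete product space, where every
  predicate is measurable; so \<open>Q\<close> can be arbitrary.\<close>

lemma pred_image_draws:
  assumes "finite B" and V: "\<And>i. i \<in> B \<Longrightarrow> V i \<in> measurable M (count_space U)"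
  shows "Measurable.pred M (\<lambda>\<omega>. Q ((\<lambda>i. V i \<omega>) ` B))"
proof -
  have "(\<lambda>\<omega>. \<lambda>i\<in>B. V i \<omega>) \<in> measurable M (PiM B (\<lambda>_. count_space U))"
    using V by (intro measurable_restrict)
  also have "PiM B (\<lambda>_. count_space U) = count_space (PiE B (\<lambda>_. U))"
    using assms(1) finite_U by (intro count_space_PiM_finite countable_finite)
  finally have "(\<lambda>\<omega>. Q ((\<lambda>i\<in>B. V i \<omega>) ` B)) \<in> measurable M (count_space UNIV)"
    by (rule measurable_compose) simp
  then show ?thesis by simp
qed

end

section \<open>Independent uniform draws realise the recursion\<close>

locale uniform_draws = monotone_collection U D + prob_space M
  for U :: "'a set" and D :: "'a set \<Rightarrow> bool" and M :: "'w measure" +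
  fixes V :: "nat \<Rightarrow> 'w \<Rightarrow> 'a"
  assumes indep: "indep_vars (\<lambda>_. count_space U) V {1..}"
    and uniform: "i \<ge> 1 \<Longrightarrow> v \<in> U \<Longrightarrow> prob {\<omega> \<in> space M. V i \<omega> = v} = 1 / real (card U)"
begin

lemma draw_measurable: "i \<ge> 1 \<Longrightarrow> V i \<in> measurable M (count_space U)"
  using indep by (simp add: indep_vars_def)

lemma draw_in_U: "i \<ge> 1 \<Longrightarrow> \<omega> \<in> space M \<Longrightarrow> V i \<omega> \<in> U"
  using draw_measurable[THEN measurable_space] by simp

text \<open>The index sets \<open>{m}\<close> and \<open>B\<close> are disjoint, so the restricted
  families are independent; both events are preimages of sets in discrete product spaces.\<close>

lemma prob_first_draw:
  assumes "1 \<le> m" and "v \<in> U" and "finite B" and "B \<subseteq> {Suc m..}"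
  shows "prob {\<omega> \<in> space M. V m \<omega> = v \<and> Q ((\<lambda>i. V i \<omega>) ` B)}
    = prob {\<omega> \<in> space M. Q ((\<lambda>i. V i \<omega>) ` B)} / real (card U)"
proof -
  let ?P = "\<lambda>B. PiM B (\<lambda>_. count_space U)"
  let ?V = "\<lambda>B \<omega>. \<lambda>i\<in>B. V i \<omega>"
  define Xa where "Xa = {f \<in> PiE {m} (\<lambda>_. U). f m = v}"
  define Xb where "Xb = {f \<in> PiE B (\<lambda>_. U). Q (f ` B)}"
  have P: "?P A = count_space (PiE A (\<lambda>_. U))" if "finite A" for A :: "nat set"
    using that finite_U by (intro count_space_PiM_finite countable_finite)
  have ind: "indep_var (?P {m}) (?V {m}) (?P B) (?V B)"
    using assms by (intro indep_var_restrict[OF indep]) auto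
  have B1: "1 \<le> i" if "i \<in> B" for i
    using that assms by auto
  have "prob ((\<lambda>\<omega>. (?V {m} \<omega>, ?V B \<omega>)) -` (Xa \<times> Xb) \<inter> space M)
    = prob (?V {m} -` Xa \<inter> space M) * prob (?V B -` Xb \<inter> space M)"
    by (rule indep_varD[OF ind]) (auto simp: P assms Xa_def Xb_def)
  moreover have "(\<lambda>\<omega>. (?V {m} \<omega>, ?V B \<omega>)) -` (Xa \<times> Xb) \<inter> space M
    = {\<omega> \<in> space M. V m \<omega> = v \<and> Q ((\<lambda>i. V i \<omega>) ` B)}"
    using assms draw_in_U B1 by (auto simp: Xa_def Xb_def)
  moreover have "?V {m} -` Xa \<inter> space M = {\<omega> \<in> space M. V m \<omega> = v}"
    using assms draw_in_U by (auto simp: Xa_def)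
  moreover have "?V B -` Xb \<inter> space M = {\<omega> \<in> space M. Q ((\<lambda>i. V i \<omega>) ` B)}"
    using draw_in_U B1 by (auto simp: Xb_def)
  ultimately show ?thesis
    using uniform[OF assms(1,2)] by simp
qed

text \<open>Splitting by the value of draw \<open>m\<close> and moving it into \<open>S\<close>
  leaves the same question for the draws from \<open>Suc m\<close> on; hence the arbitrary start
  \<open>m\<close> in the induction.\<close>

lemma prob_undone:
  "1 \<le> m \<Longrightarrow> prob {\<omega> \<in> space M. \<not> D (S \<union> (\<lambda>i. V i \<omega>) ` {m..<m + t})} = undone t S"
proof (induction t arbitrary: m S)
  case 0
  then show ?case by (simp add: prob_space)
next
  case (Suc t)
  let ?B = "{Suc m..<Suc m + t}"
  let ?E = "\<lambda>v. {\<omega> \<in> space M. V m \<omega> = v \<and> \<not> D (insert v S \<union> (\<lambda>i. V i \<omega>) ` ?B)}"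
  have "{m..<m + Suc t} = insert m ?B" by auto
  then have "{\<omega> \<in> space M. \<not> D (S \<union> (\<lambda>i. V i \<omega>) ` {m..<m + Suc t})} = (\<Union>v\<in>U. ?E v)"
    using draw_in_U[OF Suc.prems] by auto
  also have "prob \<dots> = (\<Sum>v\<in>U. prob (?E v))"
  proof (rule finite_measure_finite_Union[OF finite_U])
    have [measurable]: "Measurable.pred M (\<lambda>\<omega>. V m \<omega> = v)" for v
      using measurable_compose[OF draw_measurable[OF Suc.prems], of "\<lambda>x. x = v" "count_space UNIV"]
      by simp
    have [measurable]: "Measurable.pred M (\<lambda>\<omega>. \<not> D (insert v S \<union> (\<lambda>i. V i \<omega>) ` ?B))" for v
      using Suc.prems by (intro pred_image_draws draw_measurable) auto
    show "?E ` U \<subseteq> sets M"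
      by (rule image_subsetI) measurable
  qed (auto simp: disjoint_family_on_def)
  also have "\<dots> = (\<Sum>v\<in>U. undone t (insert v S) / real (card U))"
  proof (rule sum.cong)
    fix v assume "v \<in> U"
    then have "prob (?E v)
      = prob {\<omega> \<in> space M. \<not> D (insert v S \<union> (\<lambda>i. V i \<omega>) ` ?B)} / real (card U)"
      using Suc.prems by (intro prob_first_draw[where Q = "\<lambda>X. \<not> D (insert v S \<union> X)"]) auto
    then show "prob (?E v) = undone t (insert v S) / real (card U)"
      using Suc.IH[of "Suc m" "insert v S"] by simp
  qed simp
  finally show ?case by (simp add: sum_divide_distrib)
qed

section \<open>Moments of the completion time\<close>

definition pending :: "nat \<Rightarrow> 'w \<Rightarrow> bool" where
  "pending t \<omega> \<longleftrightarrow> \<not> D ((\<lambda>i. V i \<omega>) ` {1..t})"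

definition completion_time :: "'w \<Rightarrow> nat" where
  "completion_time \<omega> = (LEAST t. \<not> pending t \<omega>)"

lemma pending_measurable [measurable]: "Measurable.pred M (pending t)"
  unfolding pending_def by (intro pred_image_draws draw_measurable) auto

lemma prob_pending: "prob {\<omega> \<in> space M. pending t \<omega>} = undone t {}"
  using prob_undone[of 1 "{}" t]
  by (simp add: pending_def atLeastLessThanSuc_atLeastAtMost)

text \<open>Monotonicity of \<open>D\<close> makes the pending times an initial segment; the
  assumption makes the \<open>LEAST\<close> in \<open>completion_time\<close> attained.\<close>

lemma pending_iff:
  assumes "\<exists>t. \<not> pending t \<omega>"
  shows "pending s \<omega> \<longleftrightarrow> s < completion_time \<omega>"
proof
  show "s < completion_time \<omega> \<Longrightarrow> pending s \<omega>"
    unfolding completion_time_def using not_less_Least by blast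
  have not_pending: "\<not> pending (completion_time \<omega>) \<omega>"
    unfolding completion_time_def using assms by (rule LeastI_ex)
  show "s < completion_time \<omega>" if "pending s \<omega>"
  proof (rule ccontr)
    assume "\<not> s < completion_time \<omega>"
    then have "(\<lambda>i. V i \<omega>) ` {1..completion_time \<omega>} \<subseteq> (\<lambda>i. V i \<omega>) ` {1..s}" by auto
    from D_mono[OF this] show False using not_pending that by (auto simp: pending_def)
  qed
qed

lemma expectation_weighted_pending:
  "expectation (\<lambda>\<omega>. \<Sum>s<t. c s * of_bool (pending s \<omega>)) = (\<Sum>s<t. c s * undone s {})"
proof -
  have *: "(\<lambda>\<omega>. of_bool (pending s \<omega>) :: real) = indicator {\<omega>. pending s \<omega>}" for s
    by (auto simp: indicator_def)
  have "expectation (\<lambda>\<omega>. of_bool (pending s \<omega>)) = undone s {}" for s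
    unfolding * prob_pending[symmetric]
    by (simp add: Int_def conj_commute)
  moreover have "integrable M (\<lambda>\<omega>. c s * of_bool (pending s \<omega>))" for s
    by (rule integrable_const_bound[where B = "\<bar>c s\<bar>"]) auto
  ultimately show ?thesis
    by (subst Bochner_Integration.integral_sum) (simp_all del: sum_of_bool_mult_eq sum_mult_of_bool_eq)
qed

lemma undone_summable: "summable (\<lambda>t. undone t {})"
  by (rule bounded_imp_summable[OF undone_nonneg])
    (use mean_time_bounded[of "Suc _" "{}"] in \<open>simp add: mean_time_def lessThan_Suc_atMost\<close>)

text \<open>Never completing is contained in each event of being pending at \<open>t\<close>, and
  the probabilities of these are the terms of a convergent series.\<close>

lemma AE_completes: "AE \<omega> in M. \<exists>t. \<not> pending t \<omega>"
proof -
  have "prob {\<omega> \<in> space M. \<forall>t. pending t \<omega>} \<le> undone t {}" for t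
    unfolding prob_pending[symmetric] by (rule finite_measure_mono) auto
  then have "prob {\<omega> \<in> space M. \<forall>t. pending t \<omega>} \<le> 0"
    by (intro LIMSEQ_le_const[OF summable_LIMSEQ_zero[OF undone_summable]]) auto
  then have "prob {\<omega> \<in> space M. \<forall>t. pending t \<omega>} = 0"
    by (simp add: measure_le_0_iff)
  then show ?thesis
    by (subst AE_iff_measurable[OF _ refl]) (auto simp: emeasure_eq_measure)
qed

text \<open>Almost surely, \<open>f (completion_time \<omega>)\<close> is the sum of the weights
  \<open>c s\<close> over the pending times \<open>s\<close>. Its truncations at \<open>t\<close>
  increase and are eventually constant, so monotone convergence applies.\<close>

lemma completion_time_moment:
  assumes c: "\<And>s. 0 \<le> c s" and f: "\<And>t. (\<Sum>s<t. c s) = f t"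
    and lim: "(\<lambda>t. \<Sum>s<t. c s * undone s {}) \<longlonglongrightarrow> L"
  shows "integrable M (\<lambda>\<omega>. f (completion_time \<omega>) :: real)"
    and "expectation (\<lambda>\<omega>. f (completion_time \<omega>)) = L"
proof -
  let ?F = "\<lambda>t \<omega>. \<Sum>s<t. c s * of_bool (pending s \<omega>)"
  have 1: "integrable M (?F t)" for t
    by (intro Bochner_Integration.integrable_sum integrable_const_bound[where B = "\<bar>c _\<bar>"]) auto
  have 2: "AE \<omega> in M. mono (\<lambda>t. ?F t \<omega>)"
    by (intro AE_I2 monoI sum_mono2) (auto simp: c)
  have 3: "AE \<omega> in M. 0 \<le> ?F t \<omega>" for t
    by (intro AE_I2 sum_nonneg) (simp add: c)
  have 4: "AE \<omega> in M. (\<lambda>t. ?F t \<omega>) \<longlonglongrightarrow> f (completion_time \<omega>)"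
    using AE_completes
  proof eventually_elim
    case (elim \<omega>)
    have "?F t \<omega> = f (completion_time \<omega>)" if "completion_time \<omega> \<le> t" for t
      unfolding f[symmetric] using that
      by (intro sum.mono_neutral_cong_right) (auto simp: pending_iff[OF elim])
    then show ?case
      by (intro tendsto_eventually eventually_sequentiallyI)
  qed
  have 5: "(\<lambda>t. expectation (?F t)) \<longlonglongrightarrow> L"
    using lim unfolding expectation_weighted_pending .
  have "(\<lambda>\<omega>. completion_time \<omega>) \<in> measurable M (count_space UNIV)"
    unfolding completion_time_def by measurable
  then have 6: "(\<lambda>\<omega>. f (completion_time \<omega>)) \<in> borel_measurable M"
    by (rule measurable_compose) simp
  show "integrable M (\<lambda>\<omega>. f (completion_time \<omega>))"
    and "expectation (\<lambda>\<omega>. f (completion_time \<omega>)) = L"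
    using integral_monotone_convergence_nonneg[OF 1 2 3 4 5 6] by simp_all
qed

lemma completion_time_variance:
  defines "T \<equiv> \<lambda>\<omega>. real (completion_time \<omega>)"
  shows "integrable M T" and "integrable M (\<lambda>\<omega>. (T \<omega>)\<^sup>2)"
    and "variance T \<le> real (card U) * expectation T"
proof -
  let ?n = "real (card U)"
  obtain h where h: "(\<lambda>t. mean_time t {}) \<longlonglongrightarrow> h"
    using undone_summable unfolding mean_time_def summable_def sums_def by blast
  have mono: "mono (\<lambda>t. mean_time t {})"
    by (simp add: mono_iff_le_Suc mean_time_mono)
  \<comment> \<open>The means increase to \<open>h\<close>, so \<open>mean_square_time_le\<close>
    becomes a bound uniform in \<open>t\<close>; this also makes the second moments
    converge.\<close>
  have bound: "mean_square_time t {} \<le> h\<^sup>2 + ?n * h" for t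
  proof -
    have "mean_time t {} \<le> h" using mono h by (rule incseq_le)
    moreover have "0 \<le> mean_time t {}" by (simp add: mean_time_def sum_nonneg undone_nonneg)
    ultimately have "(mean_time t {})\<^sup>2 + ?n * mean_time t {} \<le> h\<^sup>2 + ?n * h"
      by (intro add_mono power_mono mult_left_mono) auto
    then show ?thesis using mean_square_time_le[of t "{}"] by linarith
  qed
  have "summable (\<lambda>s. (2 * real s + 1) * undone s {})"
    by (rule bounded_imp_summable[where B = "h\<^sup>2 + ?n * h"])
      (use bound[of "Suc _"] in \<open>simp_all add: undone_nonneg mean_square_time_def lessThan_Suc_atMost\<close>)
  then obtain g where g: "(\<lambda>t. mean_square_time t {}) \<longlonglongrightarrow> g"
    unfolding mean_square_time_def summable_def sums_def by blast
  have "g \<le> h\<^sup>2 + ?n * h"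
    using g bound by (intro LIMSEQ_le_const2) auto
  have sq: "(\<Sum>s<t. 2 * real s + 1) = (real t)\<^sup>2" for t
    by (induction t) (auto simp: power2_eq_square algebra_simps)
  \<comment> \<open>Weights 1 give the first moment \<open>h\<close>; the odd numbers, whose partial
    sums are the squares, give the second moment \<open>g\<close>.\<close>
  note first = completion_time_moment[of "\<lambda>_. 1" real h]
  note second = completion_time_moment[of "\<lambda>s. 2 * real s + 1" "\<lambda>t. (real t)\<^sup>2" g]
  show T: "integrable M T" and T2: "integrable M (\<lambda>\<omega>. (T \<omega>)\<^sup>2)"
    using first(1) second(1) h g sq by (simp_all add: T_def mean_time_def mean_square_time_def)
  have "expectation T = h" and "expectation (\<lambda>\<omega>. (T \<omega>)\<^sup>2) = g"
    using first(2) second(2) h g sq by (simp_all add: T_def mean_time_def mean_square_time_def)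
  then show "variance T \<le> ?n * expectation T"
    using variance_eq[OF T T2] \<open>g \<le> h\<^sup>2 + ?n * h\<close> by simp
qed

end

section \<open>Domination in a graph\<close>

text \<open>Almost sure domination makes the \<open>LEAST\<close> in \<open>domination_time\<close>
  meaningful; the integrability claims exclude the default value 0 of a Bochner integral in the mean
  and the variance.\<close>

theorem proposition6:
  fixes G :: "('a, 'e) pre_digraph"
    and n :: nat
    and M :: "'w measure"
    and V :: "nat \<Rightarrow> 'w \<Rightarrow> 'a"
    and T :: "'w \<Rightarrow> real"
  assumes "pseudo_graph G"
    and "card (verts G) = n"
    and "prob_space M"
    and "prob_space.indep_vars M (\<lambda>_. count_space (verts G)) V {1..}"
    and "\<And>i. i \<ge> 1 \<Longrightarrow> distr M (count_space (verts G)) (V i) = uniform_count_measure (verts G)"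
    and "\<And>\<omega>. T \<omega> = real (domination_time G (\<lambda>i. V i \<omega>))"
  shows "(AE \<omega> in M. \<exists>t. dominating_set G ((\<lambda>i. V i \<omega>) ` {1..t}))
    \<and> integrable M T \<and> integrable M (\<lambda>\<omega>. (T \<omega>)\<^sup>2)
    \<and> prob_space.variance M T \<le> real n * prob_space.expectation M T"
proof -
  interpret pseudo_graph G by fact
  interpret prob_space M by fact
  have meas: "V i \<in> measurable M (count_space (verts G))" if "1 \<le> i" for i
    using assms(4) that by (simp add: indep_vars_def)
  have "prob {\<omega> \<in> space M. V i \<omega> = v} = 1 / real (card (verts G))"
    if "1 \<le> i" "v \<in> verts G" for i v
  proof -
    have "prob {\<omega> \<in> space M. V i \<omega> = v} = prob (V i -` {v} \<inter> space M)"
      by (rule arg_cong[where f = prob]) auto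
    also have "\<dots> = measure (uniform_count_measure (verts G)) {v}"
      using that meas by (simp add: assms(5)[symmetric] measure_distr)
    also have "\<dots> = 1 / real (card (verts G))"
      using that by (simp add: measure_uniform_count_measure)
    finally show ?thesis .
  qed
  moreover have mono: "dominating_set G B" if "A \<subseteq> B" "dominating_set G A" for A B
    using that unfolding dominating_set_def by blast
  \<comment> \<open>A probability space has a point, and the first draw maps it to a vertex.\<close>
  moreover obtain \<omega> where "\<omega> \<in> space M" using not_empty by blast
  then have "verts G \<noteq> {}" using measurable_space[OF meas[of 1]] by auto
  ultimately interpret uniform_draws "verts G" "dominating_set G" M V
    using assms(4) mono by unfold_locales (auto simp: dominating_set_def[of G "verts G"])
  have T: "T = (\<lambda>\<omega>. real (completion_time \<omega>))"
    by (simp add: fun_eq_iff assms(6) completion_time_def pending_def domination_time_def)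
  show ?thesis
    using AE_completes completion_time_variance unfolding T assms(2) pending_def by simp
qed

end
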